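(* Let $p=p(n)\in[0,1]$ and $q=q(n)\in[0,1]$ satisfy $p=O(1/n^2)$ and $q=\omega(1/(n\log n))$ as $n\to\infty$, let $\tilde p=p/(p+q)$, and for each $n$ let $\mathscr G=(G_t)_{t\in\mathbb{N}}\sim\mathcal{G}(n,p,q)$ be the edge-Markovian sequence with starting graph $G_0\sim\mathcal{G}(n,\tilde p)$. Then $t_{\mathrm{mix}}(\mathcal{G}(n,p,q))=\Omega(n)$; that is, there is a constant $c>0$ such that for all sequences $\epsilon_n\to0$ and $\delta_n\to0$ and all sufficiently large $n$, $\mathbb{P}[\,t_{\mathrm{mix}}(\mathscr G;\epsilon_n)\le cn\,]<1-\delta_n$.
   Context: $\mathcal{G}(n,\tilde p)$ is the Erdős–Rényi random graph on $V=\{1,\dots,n\}$, each of the $\binom n2$ edges being present independently with probability $\tilde p$. Edge-Markovian model $\mathcal{G}(n,p,q)$: given a starting graph $G_0$ on $V$, it is the random sequence of graphs $G_t=(V,E_t)$ in which, independently over all pairs $\{u,v\}$ of distinct vertices, $\mathbb{P}[\{u,v\}\in E_{t+1}\mid G_t]$ equals $1-q$ if $\{u,v\}\in E_t$ and $p$ if $\{u,v\}\notin E_t$. Random walk: $P_t$ is the lazy random walk transition matrix on $G_t$: $P_t(u,u)=1/2$, $P_t(u,v)=1/(2\deg_t(u))$ if $\{u,v\}\in E_t$, and $P_t(u,v)=0$ otherwise, where $\deg_t(u)$ is the degree of $u$ in $G_t$; if $\deg_t(u)=0$ the walk stays at $u$, i.e. $P_t(u,u)=1$. For $x\in V$, $\mu_0^x$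 is the point mass at $x$ and $\mu_t^x=\mu_0^xP_1P_2\cdots P_t$. $\pi_t(x)=\deg_t(x)/(2|E_t|)$; if $E_t=\emptyset$, $\pi_t$ is undefined and closeness to $\pi_t$ is regarded as failing. $\|f-g\|_{TV}=\frac12\sum_{x\in V}|f(x)-g(x)|$. Mixing time: for a graph sequence $\mathscr G$ on $n$ vertices and $\epsilon>0$, $$t_{\mathrm{mix}}(\mathscr G;\epsilon)=\min\{t\in\mathbb{N}:\ \|\mu_s^x-\pi_s\|_{TV}\le\epsilon\ \text{ for all } x\in V\text{ and all integers } t\le s\le t+\sqrt n\}$$ (with $\min\emptyset=\infty$). Probabilities are over the random graph sequence (including $G_0$). *)

theory Defs
  imports "HOL-Probability.Probability" "HOL-Library.Landau_Symbols"
begin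

text \<open>A graph on the vertex set \<open>{1..n}\<close> is represented by its edge set, a subset of \<open>pairs n\<close>.\<close>

definition pairs :: "nat \<Rightarrow> nat set set" where
  "pairs n = {e. e \<subseteq> {1..n} \<and> card e = 2}"

definition degree :: "nat set set \<Rightarrow> nat \<Rightarrow> nat" where
  "degree E u = card {e \<in> E. u \<in> e}"

definition independent_edges :: "nat \<Rightarrow> (nat set \<Rightarrow> real) \<Rightarrow> nat set set pmf" where
  "independent_edges n r =
     map_pmf (\<lambda>f. {e \<in> pairs n. f e}) (Pi_pmf (pairs n) False (\<lambda>e. bernoulli_pmf (r e)))"

definition erdos_renyi :: "nat \<Rightarrow> real \<Rightarrow> nat set set pmf" where
  "erdos_renyi n r = independent_edges n (\<lambda>_. r)"

definition edge_step :: "nat \<Rightarrow> real \<Rightarrow> real \<Rightarrow> nat set set \<Rightarrow> nat set set pmf" where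
  "edge_step n p q E = independent_edges n (\<lambda>e. if e \<in> E then 1 - q else p)"

text \<open>\<open>D\<close> is the law of the starting graph.  The transition law is prescribed conditionally on the
  whole history up to time \<open>t\<close>; it is written in product form so that histories of probability
  \<open>0\<close> need no special treatment.\<close>

locale edge_markovian = prob_space M
  for M :: "'a measure" and n :: nat and p q :: real and D :: "nat set set pmf"
    and G :: "nat \<Rightarrow> 'a \<Rightarrow> nat set set" +
  assumes graph_measurable: "\<And>t. G t \<in> measurable M (count_space (Pow (pairs n)))"
    and start_law: "\<And>E. prob {\<omega> \<in> space M. G 0 \<omega> = E} = pmf D E"
    and transition_law: "\<And>t E. prob {\<omega> \<in> space M. \<forall>s\<le>Suc t. G s \<omega> = E s} =
           prob {\<omega> \<in> space M. \<forall>s\<le>t. G s \<omega> = E s} * pmf (edge_step n p q (E t)) (E (Suc t))"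

definition lazy_walk :: "nat set set \<Rightarrow> nat \<Rightarrow> nat \<Rightarrow> real" where
  "lazy_walk E u v =
     (if degree E u = 0 then (if u = v then 1 else 0)
      else if u = v then 1 / 2
      else if {u, v} \<in> E then 1 / (2 * real (degree E u))
      else 0)"

text \<open>The step from time \<open>t\<close> to time \<open>Suc t\<close> uses the graph at time \<open>Suc t\<close>; the graph at
  time \<open>0\<close> is not used.\<close>

primrec walk_dist :: "nat \<Rightarrow> (nat \<Rightarrow> nat set set) \<Rightarrow> nat \<Rightarrow> nat \<Rightarrow> nat \<Rightarrow> real" where
  "walk_dist n \<G> x 0 = (\<lambda>y. if y = x then 1 else 0)"
| "walk_dist n \<G> x (Suc t) = (\<lambda>y. \<Sum>u\<in>{1..n}. walk_dist n \<G> x t u * lazy_walk (\<G> (Suc t)) u y)"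

definition stationary :: "nat set set \<Rightarrow> nat \<Rightarrow> real" where
  "stationary E x = real (degree E x) / (2 * real (card E))"

definition tv_dist :: "nat \<Rightarrow> (nat \<Rightarrow> real) \<Rightarrow> (nat \<Rightarrow> real) \<Rightarrow> real" where
  "tv_dist n f g = 1 / 2 * (\<Sum>x\<in>{1..n}. \<bar>f x - g x\<bar>)"

text \<open>On \<^typ>\<open>enat\<close> the infimum of the empty set is \<open>\<infinity>\<close>.  For an edgeless graph the
  distribution \<open>stationary\<close> is meaningless, and closeness to it counts as failing.\<close>

definition t_mix :: "nat \<Rightarrow> (nat \<Rightarrow> nat set set) \<Rightarrow> real \<Rightarrow> enat" where
  "t_mix n \<G> \<epsilon> = Inf (enat ` {t. \<forall>x\<in>{1..n}. \<forall>s. t \<le> s \<and> real s \<le> real t + sqrt (real n) \<longrightarrow>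
     \<G> s \<noteq> {} \<and> tv_dist n (walk_dist n \<G> x s) (stationary (\<G> s)) \<le> \<epsilon>})"

end

theory Submission
  imports Defs "HOL-Real_Asymp.Real_Asymp"
begin

text \<open>
  A vertex that has no incident edge at any time up to \<open>T\<close> keeps the walk that starts there in
  place, while \<open>stationary\<close> gives it mass \<open>0\<close>.  As long as such a vertex exists, the walk is far
  from stationarity at every time up to \<open>T\<close>, hence \<open>t_mix > T\<close> (\<open>t_mix_gt_of_isolated\<close>).  With
  \<open>T = n\<close>, so with constant \<open>c = 1\<close>, such a vertex exists with probability tending to \<open>1\<close>.

  A given pair is absent throughout \<open>0, \<dots>, n\<close> exactly if it is absent at the start and never
  appears, and distinct pairs evolve independently; so a set \<open>S\<close> of pairs is avoided
  throughout with probability \<open>a ^ card S\<close>, where \<open>a = (1 - r) * (1 - p) ^ n\<close> and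
  \<open>r = p / (p + q)\<close> (\<open>prob_avoid\<close>).  The \<open>n - 1\<close> pairs at a vertex form a star, and two
  stars share only one pair.  Being permanently isolated therefore has probability
  \<open>a ^ (n - 1)\<close> for one vertex and \<open>a ^ (2 * n - 3)\<close> for two vertices: the events are nearly
  uncorrelated.  Chebyshev's inequality bounds the probability that no vertex is
  permanently isolated by \<open>1 / (n * a ^ (n - 1)) + (1 / a - 1)\<close> (\<open>prob_t_mix_le\<close>).

  It remains to see that this tends to \<open>0\<close>.  We have \<open>1 - a \<le> r + n * p\<close>.  Since
  \<open>p = O(1 / n\<^sup>2)\<close>, the bound \<open>n * p\<close> for the chance that an absent pair appears is \<open>O(1 / n)\<close>, and since
  \<open>q\<close> exceeds every multiple of \<open>1 / (n ln n)\<close>, the initial density \<open>r \<le> p / q\<close> is \<open>o(ln n / n)\<close>.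
  So eventually \<open>1 - a \<le> ln n / (4 * n)\<close> (\<open>stationary_edge_density_le\<close>), which gives
  \<open>a ^ n \<ge> 1 / sqrt n\<close> and an expected number of at least \<open>sqrt n\<close> permanently isolated
  vertices (\<open>second_moment_bound\<close>).
\<close>

section \<open>Edge sets avoided by the edge-Markovian graph\<close>

lemma finite_pairs: "finite (pairs n)"
  unfolding pairs_def by (rule finite_subset[of _ "Pow {1..n}"]) auto

lemma prob_independent_edges_avoid:
  assumes "S \<subseteq> pairs n" and r: "\<And>e. e \<in> S \<Longrightarrow> 0 \<le> r e \<and> r e \<le> 1"
  shows "measure_pmf.prob (independent_edges n r) (Pow (pairs n - S)) = (\<Prod>e\<in>S. 1 - r e)"
proof -
  define B where "B e = (if e \<in> S then {False} else UNIV)" for e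
  have "measure_pmf.prob (independent_edges n r) (Pow (pairs n - S)) =
      measure_pmf.prob (Pi_pmf (pairs n) False (\<lambda>e. bernoulli_pmf (r e))) (Pi (pairs n) B)"
    unfolding independent_edges_def using assms(1)
    by (auto simp: B_def Pi_def intro!: arg_cong2[where f = measure])
  also have "\<dots> = (\<Prod>e\<in>pairs n. measure_pmf.prob (bernoulli_pmf (r e)) (B e))"
    by (rule measure_Pi_pmf_Pi[OF finite_pairs])
  also have "\<dots> = (\<Prod>e\<in>S. measure_pmf.prob (bernoulli_pmf (r e)) (B e))"
    using assms(1) by (intro prod.mono_neutral_right finite_pairs) (auto simp: B_def)
  also have "\<dots> = (\<Prod>e\<in>S. 1 - r e)"
    using r by (intro prod.cong) (auto simp: B_def measure_pmf_single)
  finally show ?thesis .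
qed

context edge_markovian
begin

lemma events_graphs: "{\<omega> \<in> space M. G s \<omega> \<in> B} \<in> events"
proof -
  have "G s \<omega> \<in> Pow (pairs n)" if "\<omega> \<in> space M" for \<omega>
    using measurable_space[OF graph_measurable[of s] that] by simp
  then have "{\<omega> \<in> space M. G s \<omega> \<in> B} = G s -` (B \<inter> Pow (pairs n)) \<inter> space M"
    by blast
  then show ?thesis
    using measurable_sets[OF graph_measurable[of s], of "B \<inter> Pow (pairs n)"] by simp
qed

text \<open>The evolution is only known through the probabilities of complete histories.  An event
  about the whole past is therefore split into the finitely many histories that realise it;
  if the chance of staying in \<open>B\<close> is the same \<open>k\<close> from every state in \<open>B\<close>, each further
  step multiplies the total by \<open>k\<close>.\<close>

lemma prob_stay_in:
  assumes B: "B \<subseteq> Pow (pairs n)"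
    and step: "\<And>E. E \<in> B \<Longrightarrow> measure_pmf.prob (edge_step n p q E) B = k"
  shows "prob {\<omega> \<in> space M. \<forall>s\<le>t. G s \<omega> \<in> B} = measure_pmf.prob D B * k ^ t"
proof -
  define hist where "hist t = (PiE {..t} (\<lambda>_. B))" for t :: nat
  define path where "path t E = {\<omega> \<in> space M. \<forall>s\<le>t. G s \<omega> = E s}" for t :: nat and E
  have fB: "finite B"
    using B finite_pairs by (meson finite_Pow_iff finite_subset)
  have fin: "finite (hist t)" for t
    unfolding hist_def by (intro finite_PiE fB) auto
  have path_events: "path t E \<in> events" for t E
  proof -
    have "path t E = {\<omega> \<in> space M. \<forall>s\<in>{..t}. G s \<omega> \<in> {E s}}"
      by (auto simp: path_def)
    also have "\<dots> \<in> events"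
      by (intro sets.sets_Collect_finite_All events_graphs) auto
    finally show ?thesis .
  qed
  have disj: "disjoint_family_on (path t) (hist t)" for t
  proof -
    have "E = E'" if "E \<in> hist t" "E' \<in> hist t" "\<omega> \<in> path t E" "\<omega> \<in> path t E'" for E E' \<omega>
      using that unfolding hist_def path_def by (intro PiE_ext[of E _ _ E']) auto
    then show ?thesis
      unfolding disjoint_family_on_def by blast
  qed
  have decomp: "{\<omega> \<in> space M. \<forall>s\<le>t. G s \<omega> \<in> B} = (\<Union>E\<in>hist t. path t E)" for t
  proof (intro equalityI subsetI)
    fix \<omega> assume "\<omega> \<in> {\<omega> \<in> space M. \<forall>s\<le>t. G s \<omega> \<in> B}"
    then have "restrict (\<lambda>s. G s \<omega>) {..t} \<in> hist t" "\<omega> \<in> path t (restrict (\<lambda>s. G s \<omega>) {..t})"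
      by (auto simp: hist_def path_def)
    then show "\<omega> \<in> (\<Union>E\<in>hist t. path t E)" by blast
  next
    fix \<omega> assume "\<omega> \<in> (\<Union>E\<in>hist t. path t E)"
    then show "\<omega> \<in> {\<omega> \<in> space M. \<forall>s\<le>t. G s \<omega> \<in> B}"
      by (auto simp: hist_def path_def PiE_def Pi_def)
  qed
  have total: "prob {\<omega> \<in> space M. \<forall>s\<le>t. G s \<omega> \<in> B} = (\<Sum>E\<in>hist t. prob (path t E))" for t
    unfolding decomp by (intro finite_measure_finite_Union fin disj) (use path_events in auto)
  show ?thesis
  proof (induction t)
    case 0
    have "{\<omega> \<in> space M. \<forall>s\<le>0. G s \<omega> \<in> B} = (\<Union>E\<in>B. {\<omega> \<in> space M. G 0 \<omega> \<in> {E}})"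
      by auto
    also have "prob \<dots> = (\<Sum>E\<in>B. prob {\<omega> \<in> space M. G 0 \<omega> \<in> {E}})"
    proof (intro finite_measure_finite_Union fB)
      show "(\<lambda>E. {\<omega> \<in> space M. G 0 \<omega> \<in> {E}}) ` B \<subseteq> events"
        by (intro image_subsetI events_graphs)
      show "disjoint_family_on (\<lambda>E. {\<omega> \<in> space M. G 0 \<omega> \<in> {E}}) B"
        by (auto simp: disjoint_family_on_def)
    qed
    finally show ?case
      by (simp add: start_law measure_measure_pmf_finite[OF fB])
  next
    case (Suc t)
    have "prob {\<omega> \<in> space M. \<forall>s\<le>Suc t. G s \<omega> \<in> B} = (\<Sum>E\<in>hist (Suc t). prob (path (Suc t) E))"
      by (rule total)
    also have "\<dots> = (\<Sum>(F, E)\<in>B \<times> hist t. prob (path (Suc t) (E(Suc t := F))))"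
    proof -
      have "hist (Suc t) = (\<lambda>(F, E). E(Suc t := F)) ` (B \<times> hist t)"
        unfolding hist_def atMost_Suc by (rule PiE_insert_eq)
      moreover have "inj_on (\<lambda>(F, E). E(Suc t := F)) (B \<times> hist t)"
        unfolding hist_def by (rule inj_combinator) auto
      ultimately show ?thesis
        by (simp add: sum.reindex case_prod_unfold)
    qed
    also have "\<dots> = (\<Sum>(F, E)\<in>B \<times> hist t. prob (path t E) * pmf (edge_step n p q (E t)) F)"
    proof (intro sum.cong refl, clarify)
      fix F E
      have "path t (E(Suc t := F)) = path t E"
        by (auto simp: path_def)
      then show "prob (path (Suc t) (E(Suc t := F))) = prob (path t E) * pmf (edge_step n p q (E t)) F"
        using transition_law[of t "E(Suc t := F)"] by (simp add: path_def)
    qed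
    also have "\<dots> = (\<Sum>E\<in>hist t. \<Sum>F\<in>B. prob (path t E) * pmf (edge_step n p q (E t)) F)"
      by (subst sum.swap) (simp add: sum.cartesian_product)
    also have "\<dots> = (\<Sum>E\<in>hist t. prob (path t E) * k)"
    proof (intro sum.cong refl)
      fix E assume "E \<in> hist t"
      then have "E t \<in> B" by (auto simp: hist_def)
      then show "(\<Sum>F\<in>B. prob (path t E) * pmf (edge_step n p q (E t)) F) = prob (path t E) * k"
        using step by (simp add: measure_measure_pmf_finite[OF fB] sum_distrib_left[symmetric])
    qed
    also have "\<dots> = measure_pmf.prob D B * k ^ Suc t"
      using Suc.IH total[of t] by (simp add: sum_distrib_right[symmetric])
    finally show ?case .
  qed
qed

text \<open>As long as the graph avoids \<open>S\<close>, the pairs in \<open>S\<close> are all absent, so each appears in the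
  next step with probability \<open>p\<close>, whatever the rest of the graph is.\<close>

lemma prob_avoid:
  assumes S: "S \<subseteq> pairs n" and D: "D = erdos_renyi n r"
    and r: "0 \<le> r" "r \<le> 1" and p: "0 \<le> p" "p \<le> 1"
  shows "prob {\<omega> \<in> space M. \<forall>s\<le>t. G s \<omega> \<in> Pow (pairs n - S)} = ((1 - r) * (1 - p) ^ t) ^ card S"
proof -
  have "measure_pmf.prob (edge_step n p q E) (Pow (pairs n - S)) = (1 - p) ^ card S"
    if "E \<in> Pow (pairs n - S)" for E
  proof -
    have "measure_pmf.prob (edge_step n p q E) (Pow (pairs n - S)) =
        (\<Prod>e\<in>S. 1 - (if e \<in> E then 1 - q else p))"
      unfolding edge_step_def using that p by (intro prob_independent_edges_avoid S) auto
    also have "\<dots> = (\<Prod>e\<in>S. 1 - p)"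
      using that by (intro prod.cong) auto
    finally show ?thesis by simp
  qed
  then have "prob {\<omega> \<in> space M. \<forall>s\<le>t. G s \<omega> \<in> Pow (pairs n - S)} =
      measure_pmf.prob D (Pow (pairs n - S)) * ((1 - p) ^ card S) ^ t"
    by (intro prob_stay_in) auto
  also have "measure_pmf.prob D (Pow (pairs n - S)) = (1 - r) ^ card S"
    unfolding D erdos_renyi_def using S r by (subst prob_independent_edges_avoid) auto
  finally show ?thesis
    by (simp add: power_mult_distrib mult.commute flip: power_mult)
qed

end

section \<open>The second moment method\<close>

text \<open>If none of the events occurs, their number \<open>X\<close> deviates from its mean \<open>card I * r\<close> by the
  full mean, and Chebyshev's inequality bounds this by \<open>variance X / (card I * r)\<^sup>2\<close>.  The
  diagonal of the second moment contributes \<open>1 / (card I * r)\<close>, and the off-diagonal part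
  contributes at most the correlation ratio \<open>b / r\<^sup>2\<close> minus \<open>1\<close>.\<close>

lemma (in prob_space) prob_none_le_second_moment:
  fixes A :: "'i \<Rightarrow> 'a set" and r b :: real
  assumes I: "finite I" "I \<noteq> {}" and ev: "\<And>i. i \<in> I \<Longrightarrow> A i \<in> events"
    and single: "\<And>i. i \<in> I \<Longrightarrow> prob (A i) = r" and r: "r > 0"
    and double: "\<And>i j. i \<in> I \<Longrightarrow> j \<in> I \<Longrightarrow> i \<noteq> j \<Longrightarrow> prob (A i \<inter> A j) = b"
    and b: "0 \<le> b"
  shows "prob {\<omega> \<in> space M. \<forall>i\<in>I. \<omega> \<notin> A i} \<le> 1 / (card I * r) + (b / r\<^sup>2 - 1)"
proof -
  define m where "m = real (card I)"
  have m: "m \<ge> 1" using I by (simp add: m_def Suc_leI card_gt_0_iff)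
  define X where "X \<omega> = (\<Sum>i\<in>I. indicator (A i) \<omega> :: real)" for \<omega>
  have sq: "(X \<omega>)\<^sup>2 = (\<Sum>i\<in>I. \<Sum>j\<in>I. indicator (A i \<inter> A j) \<omega>)" for \<omega>
    unfolding X_def power2_eq_square sum_product by (simp add: indicator_inter_arith)
  have int1: "integrable M (indicator (A i) :: _ \<Rightarrow> real)" if "i \<in> I" for i
    using ev[OF that] by (simp add: integrable_indicator_iff emeasure_eq_measure)
  have int2: "integrable M (indicator (A i \<inter> A j) :: _ \<Rightarrow> real)" if "i \<in> I" "j \<in> I" for i j
    using ev that by (simp add: integrable_indicator_iff emeasure_eq_measure)
  have X [measurable]: "X \<in> borel_measurable M"
    unfolding X_def using ev by measurable
  have EX: "expectation X = m * r"
    unfolding X_def using ev int1 single by (simp add: m_def Bochner_Integration.integral_sum)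
  have intX: "integrable M X"
    unfolding X_def using int1 by auto
  have intX2: "integrable M (\<lambda>\<omega>. (X \<omega>)\<^sup>2)"
    unfolding sq using int2 by (intro Bochner_Integration.integrable_sum) auto
  have row: "(\<Sum>j\<in>I. prob (A i \<inter> A j)) = r + (m - 1) * b" if "i \<in> I" for i
  proof -
    have "(\<Sum>j\<in>I. prob (A i \<inter> A j)) = prob (A i \<inter> A i) + (\<Sum>j\<in>I - {i}. prob (A i \<inter> A j))"
      by (rule sum.remove[OF I(1) that])
    also have "(\<Sum>j\<in>I - {i}. prob (A i \<inter> A j)) = (\<Sum>j\<in>I - {i}. b)"
      using that double by (intro sum.cong) auto
    finally show ?thesis
      using that single I m by (simp add: m_def of_nat_diff card_Diff_singleton)
  qed
  have EX2: "expectation (\<lambda>\<omega>. (X \<omega>)\<^sup>2) = m * (r + (m - 1) * b)"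
  proof -
    have "expectation (\<lambda>\<omega>. (X \<omega>)\<^sup>2) = (\<Sum>i\<in>I. \<Sum>j\<in>I. prob (A i \<inter> A j))"
      unfolding sq using int2 ev
      by (subst Bochner_Integration.integral_sum, (auto intro!: Bochner_Integration.integrable_sum)[1],
          intro sum.cong refl, subst Bochner_Integration.integral_sum) auto
    then show ?thesis using row by (simp add: m_def)
  qed
  have var: "variance X = m * (r + (m - 1) * b) - (m * r)\<^sup>2"
    using variance_eq[OF intX intX2] EX EX2 by simp
  have "prob {\<omega> \<in> space M. \<forall>i\<in>I. \<omega> \<notin> A i} \<le> prob {\<omega> \<in> space M. m * r \<le> \<bar>X \<omega> - expectation X\<bar>}"
  proof (intro finite_measure_mono)
    show "{\<omega> \<in> space M. m * r \<le> \<bar>X \<omega> - expectation X\<bar>} \<in> events" by measurable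
  qed (use m r in \<open>auto simp: X_def EX\<close>)
  also have "\<dots> \<le> variance X / (m * r)\<^sup>2"
    using m r by (intro Chebyshev_inequality X intX2) auto
  also have "\<dots> = 1 / (m * r) + ((m - 1) * b / (m * r\<^sup>2) - 1)"
    unfolding var using m r by (simp add: field_simps power2_eq_square)
  also have "\<dots> \<le> 1 / (m * r) + (b / r\<^sup>2 - 1)"
    using m r b by (simp add: field_simps)
  finally show ?thesis by (simp add: m_def)
qed

section \<open>Isolated vertices\<close>

definition star :: "nat \<Rightarrow> nat \<Rightarrow> nat set set" where
  "star n x = {e \<in> pairs n. x \<in> e}"

lemma star_eq_image:
  assumes "x \<in> {1..n}"
  shows "star n x = (\<lambda>y. {x, y}) ` ({1..n} - {x})"
  using assms by (auto simp: star_def pairs_def card_2_iff)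

lemma card_star:
  assumes "x \<in> {1..n}"
  shows "card (star n x) = n - 1"
  unfolding star_eq_image[OF assms] using assms
  by (subst card_image) (auto simp: inj_on_def doubleton_eq_iff)

text \<open>The pair \<open>{x, y}\<close> lies in both stars and is the only one to do so.  This single common pair
  is the whole correlation between the isolation of \<open>x\<close> and that of \<open>y\<close>.\<close>

lemma card_star_Un:
  assumes "x \<in> {1..n}" "y \<in> {1..n}" "x \<noteq> y"
  shows "card (star n x \<union> star n y) + 1 = 2 * (n - 1)"
proof -
  have "star n x \<inter> star n y = {{x, y}}"
    using assms by (auto simp: star_def pairs_def card_2_iff)
  moreover have "finite (star n x)" "finite (star n y)"
    by (auto simp: star_def finite_pairs)
  ultimately show ?thesis
    using card_Un_Int[of "star n x" "star n y"] assms by (simp add: card_star)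
qed

lemma degree_avoid_star:
  assumes "E \<subseteq> pairs n - star n x"
  shows "degree E x = 0"
proof -
  have "{e \<in> E. x \<in> e} = {}"
    using assms by (auto simp: star_def)
  then show ?thesis unfolding degree_def by (metis card.empty)
qed

lemma walk_dist_isolated:
  assumes x: "x \<in> {1..n}" and iso: "\<And>s. s \<le> t \<Longrightarrow> degree (\<G> s) x = 0"
  shows "walk_dist n \<G> x t = (\<lambda>y. if y = x then 1 else 0)"
  using iso
proof (induction t)
  case (Suc t)
  then have IH: "walk_dist n \<G> x t = (\<lambda>y. if y = x then 1 else 0)" by simp
  have "walk_dist n \<G> x (Suc t) y = lazy_walk (\<G> (Suc t)) x y" for y
    using x by (simp add: IH if_distrib[of "\<lambda>c. c * _"] cong: if_cong)
  then show ?case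
    using Suc.prems[of "Suc t"] by (auto simp: lazy_walk_def)
qed simp

text \<open>The window of length \<open>sqrt n\<close> in the definition of the mixing time contains its left end,
  so already the time \<open>t = t_mix\<close> itself would have to satisfy the closeness condition.  At
  any time \<open>t \<le> T\<close> the walk from \<open>x\<close> has mass \<open>1\<close> at \<open>x\<close>, where \<open>stationary\<close> vanishes; this
  term alone makes the distance at least \<open>1 / 2\<close>.\<close>

lemma t_mix_gt_of_isolated:
  assumes x: "x \<in> {1..n}" and iso: "\<And>s. s \<le> T \<Longrightarrow> degree (\<G> s) x = 0" and \<epsilon>: "\<epsilon> < 1 / 2"
  shows "enat T < t_mix n \<G> \<epsilon>"
proof (rule ccontr)
  define good where "good = {t. \<forall>x\<in>{1..n}. \<forall>s. t \<le> s \<and> real s \<le> real t + sqrt (real n) \<longrightarrow>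
     \<G> s \<noteq> {} \<and> tv_dist n (walk_dist n \<G> x s) (stationary (\<G> s)) \<le> \<epsilon>}"
  assume "\<not> enat T < t_mix n \<G> \<epsilon>"
  then have le: "Inf (enat ` good) \<le> enat T"
    by (simp add: t_mix_def good_def)
  then have "good \<noteq> {}"
    by (auto simp: Inf_enat_def)
  then have "Inf (enat ` good) \<in> enat ` good"
    by (meson ex_in_conv image_eqI wellorder_InfI)
  then obtain t where t: "t \<in> good" "t \<le> T"
    using le by auto
  then have tv: "tv_dist n (walk_dist n \<G> x t) (stationary (\<G> t)) \<le> \<epsilon>"
    using x by (auto simp: good_def)
  have "1 = \<bar>walk_dist n \<G> x t x - stationary (\<G> t) x\<bar>"
    using t walk_dist_isolated[OF x, of t \<G>] iso by (simp add: stationary_def)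
  also have "\<dots> \<le> (\<Sum>y\<in>{1..n}. \<bar>walk_dist n \<G> x t y - stationary (\<G> t) y\<bar>)"
    using x by (intro member_le_sum) auto
  finally show False
    using tv \<epsilon> by (simp add: tv_dist_def)
qed

text \<open>The second moment method for the events that a vertex is isolated at all times up to \<open>T\<close>.
  By the common pair of two stars the correlation ratio is \<open>1 / a\<close>.\<close>

lemma (in edge_markovian) prob_t_mix_le:
  assumes D: "D = erdos_renyi n r" and r: "0 \<le> r" "r \<le> 1" and p: "0 \<le> p" "p \<le> 1"
    and n: "n \<ge> 2" and a: "a = (1 - r) * (1 - p) ^ T" "a > 0" and \<epsilon>: "\<epsilon> < 1 / 2"
  shows "prob {\<omega> \<in> space M. t_mix n (\<lambda>t. G t \<omega>) \<epsilon> \<le> enat T} \<le> 1 / (real n * a ^ (n - 1)) + (1 / a - 1)"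
proof -
  define A where "A S = {\<omega> \<in> space M. \<forall>s\<le>T. G s \<omega> \<in> Pow (pairs n - S)}" for S
  have ev: "A S \<in> events" for S
  proof -
    have "A S = {\<omega> \<in> space M. \<forall>s\<in>{..T}. G s \<omega> \<in> Pow (pairs n - S)}"
      by (auto simp: A_def)
    also have "\<dots> \<in> events"
      by (intro sets.sets_Collect_finite_All events_graphs) auto
    finally show ?thesis .
  qed
  have sub: "star n x \<subseteq> pairs n" for x by (auto simp: star_def)
  have prob_A: "prob (A S) = a ^ card S" if "S \<subseteq> pairs n" for S
    unfolding A_def a by (rule prob_avoid[OF that D r p])
  have double: "prob (A (star n x) \<inter> A (star n y)) = (a ^ (n - 1))\<^sup>2 / a"
    if "x \<in> {1..n}" "y \<in> {1..n}" "x \<noteq> y" for x y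
  proof -
    have "A (star n x) \<inter> A (star n y) = A (star n x \<union> star n y)"
      by (auto simp: A_def)
    then have "prob (A (star n x) \<inter> A (star n y)) * a = a ^ (card (star n x \<union> star n y) + 1)"
      using sub by (simp add: prob_A)
    also have "\<dots> = (a ^ (n - 1))\<^sup>2"
      unfolding card_star_Un[OF that] by (simp add: mult.commute flip: power_mult)
    finally show ?thesis
      using a(2) by (simp add: field_simps)
  qed
  have "prob {\<omega> \<in> space M. t_mix n (\<lambda>t. G t \<omega>) \<epsilon> \<le> enat T} \<le>
      prob {\<omega> \<in> space M. \<forall>x\<in>{1..n}. \<omega> \<notin> A (star n x)}"
  proof (intro finite_measure_mono subsetI)
    fix \<omega> assume \<omega>: "\<omega> \<in> {\<omega> \<in> space M. t_mix n (\<lambda>t. G t \<omega>) \<epsilon> \<le> enat T}"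
    have "\<omega> \<notin> A (star n x)" if "x \<in> {1..n}" for x
    proof
      assume "\<omega> \<in> A (star n x)"
      then have "degree (G s \<omega>) x = 0" if "s \<le> T" for s
        using that by (intro degree_avoid_star[of _ n]) (auto simp: A_def)
      then have "enat T < t_mix n (\<lambda>t. G t \<omega>) \<epsilon>"
        by (intro t_mix_gt_of_isolated[OF that _ \<epsilon>])
      then show False using \<omega> by auto
    qed
    then show "\<omega> \<in> {\<omega> \<in> space M. \<forall>x\<in>{1..n}. \<omega> \<notin> A (star n x)}"
      using \<omega> by auto
  next
    show "{\<omega> \<in> space M. \<forall>x\<in>{1..n}. \<omega> \<notin> A (star n x)} \<in> events"
      using ev by (intro sets.sets_Collect_finite_All) (auto intro: sets.sets_Collect_neg)
  qed
  also have "\<dots> \<le> 1 / (card {1..n} * a ^ (n - 1)) + ((a ^ (n - 1))\<^sup>2 / a / (a ^ (n - 1))\<^sup>2 - 1)"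
    using n a(2) ev sub double
    by (intro prob_none_le_second_moment) (auto simp: prob_A card_star)
  also have "\<dots> = 1 / (real n * a ^ (n - 1)) + (1 / a - 1)"
    using a(2) by simp
  finally show ?thesis .
qed

section \<open>Asymptotics\<close>

text \<open>The left-hand side is a union bound for a pair being present at the start or appearing in
  one of \<open>n\<close> steps.  A bound \<open>\<kappa> * ln n / n\<close> leaves about \<open>n powr (1 - \<kappa>)\<close> permanently isolated
  vertices in expectation, so any \<open>\<kappa> < 1\<close> is good enough; \<open>1 / 4\<close> leaves room for crude estimates.\<close>

lemma stationary_edge_density_le:
  fixes p q :: "nat \<Rightarrow> real"
  assumes p: "\<And>n. 0 \<le> p n" and q: "\<And>n. 0 \<le> q n"
    and pO: "p \<in> O(\<lambda>n. 1 / real n ^ 2)"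
    and q\<omega>: "q \<in> \<omega>(\<lambda>n. 1 / (real n * ln (real n)))"
  shows "\<forall>\<^sub>F n in sequentially. p n / (p n + q n) + real n * p n \<le> ln (real n) / (4 * real n)"
proof -
  obtain C where C: "C > 0" and "\<forall>\<^sub>F n in sequentially. norm (p n) \<le> C * norm (1 / real n ^ 2)"
    using landau_o.bigE[OF pO] by blast
  then have ev_p: "\<forall>\<^sub>F n in sequentially. p n \<le> C / real n ^ 2"
    using p by (auto elim!: eventually_mono)
  \<comment> \<open>The factor \<open>8\<close> makes the first summand at most half of the right-hand side.\<close>
  have ev_q: "\<forall>\<^sub>F n in sequentially. norm (q n) \<ge> (8 * C) * norm (1 / (real n * ln (real n)))"
    using landau_omega.smallD[OF q\<omega>, of "8 * C"] C by simp
  have "\<forall>\<^sub>F n in sequentially. ln (real n) \<ge> 8 * C"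
    using filterlim_compose[OF ln_at_top filterlim_real_sequentially]
    by (simp add: filterlim_at_top)
  then show ?thesis
    using ev_p ev_q eventually_gt_at_top[of 1]
  proof eventually_elim
    case (elim n)
    then have n: "real n > 1" and ln: "ln (real n) > 0" by auto
    have "8 * C / (real n * ln (real n)) \<le> q n"
      using elim(3) n ln q[of n] by simp
    moreover have pos: "8 * C / (real n * ln (real n)) > 0"
      using C n ln by simp
    ultimately have "p n / (p n + q n) \<le> (C / real n ^ 2) / (8 * C / (real n * ln (real n)))"
      using elim(2) p[of n] C by (intro frac_le) auto
    also have "\<dots> = ln (real n) / (8 * real n)"
      using C n ln by (simp add: field_simps power2_eq_square)
    finally have 1: "p n / (p n + q n) \<le> ln (real n) / (8 * real n)" .
    have "real n * p n \<le> real n * (C / real n ^ 2)"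
      using elim(2) n by (intro mult_left_mono) auto
    also have "\<dots> = C / real n"
      using n by (simp add: field_simps power2_eq_square)
    also have "\<dots> \<le> (ln (real n) / 8) / real n"
      using elim(1) n by (intro divide_right_mono) auto
    finally show ?case using 1 by simp
  qed
qed

text \<open>With \<open>h = ln n / (4 * n)\<close>, the inequality \<open>1 - h \<ge> exp (- 2 * h)\<close>, valid for
  \<open>0 \<le> h \<le> 1 / 2\<close>, gives \<open>a ^ n \<ge> exp (- ln n / 2) = 1 / sqrt n\<close>, and \<open>1 / a \<le> 1 + 2 * h\<close>.\<close>

lemma second_moment_bound:
  fixes a :: real
  assumes n: "n \<ge> 1" and a: "1 - ln (real n) / (4 * real n) \<le> a" "a \<le> 1"
  shows "1 / (real n * a ^ (n - 1)) + (1 / a - 1) \<le> 1 / sqrt (real n) + ln (real n) / (2 * real n)"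
proof -
  define h where "h = ln (real n) / (4 * real n)"
  have h: "0 \<le> h" "h \<le> 1 / 2" "1 - h \<le> a"
    using n ln_bound[of "real n"] a by (auto simp: h_def divide_simps)
  then have a0: "a > 0" by auto
  have "exp (- 2 * h) \<le> 1 / (1 + 2 * h)"
    using h exp_ge_add_one_self[of "2 * h"] by (simp add: exp_minus field_simps)
  also have "\<dots> \<le> 1 - h"
  proof -
    have "h * (2 * h) \<le> h * 1"
      using h by (intro mult_left_mono) auto
    then show ?thesis using h by (simp add: divide_simps algebra_simps)
  qed
  finally have exp_le: "exp (- 2 * h) \<le> a" using h by simp
  have "1 / sqrt (real n) = exp (- (ln (real n) / 2))"
    using n by (simp add: exp_minus inverse_eq_divide flip: ln_sqrt)
  also have "\<dots> = exp (- 2 * h) ^ n"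
    using n by (simp add: h_def flip: exp_of_nat_mult)
  also have "\<dots> \<le> a ^ n"
    using exp_le by (intro power_mono) auto
  also have "\<dots> \<le> a ^ (n - 1)"
    using a0 a by (intro power_decreasing) auto
  finally have "real n * (1 / sqrt (real n)) \<le> real n * a ^ (n - 1)"
    by (intro mult_left_mono) auto
  then have "sqrt (real n) \<le> real n * a ^ (n - 1)"
    by (simp add: real_div_sqrt)
  then have "1 / (real n * a ^ (n - 1)) \<le> 1 / sqrt (real n)"
    using n by (intro divide_left_mono) (auto simp: a0)
  moreover have "1 / a \<le> 1 + 2 * h"
  proof -
    have "h * (2 * h) \<le> h * 1"
      using h by (intro mult_left_mono) auto
    then have "1 \<le> (1 + 2 * h) * (1 - h)" by (simp add: algebra_simps)
    also have "\<dots> \<le> (1 + 2 * h) * a"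
      using h by (intro mult_left_mono) auto
    finally show ?thesis using a0 by (simp add: field_simps)
  qed
  ultimately show ?thesis by (simp add: h_def)
qed

theorem proposition1p4:
  fixes p q :: "nat \<Rightarrow> real"
    and M :: "nat \<Rightarrow> 'a measure"
    and G :: "nat \<Rightarrow> nat \<Rightarrow> 'a \<Rightarrow> nat set set"
  assumes "\<And>n. 0 \<le> p n \<and> p n \<le> 1"
    and "\<And>n. 0 \<le> q n \<and> q n \<le> 1"
    and "p \<in> O(\<lambda>n. 1 / real n ^ 2)"
    and "q \<in> \<omega>(\<lambda>n. 1 / (real n * ln (real n)))"
    and "\<And>n. edge_markovian (M n) n (p n) (q n) (erdos_renyi n (p n / (p n + q n))) (G n)"
  shows "\<exists>c::real. c > 0 \<and>
    (\<forall>\<epsilon> \<delta> :: nat \<Rightarrow> real. (\<forall>n. \<epsilon> n > 0) \<longrightarrow> \<epsilon> \<longlonglongrightarrow> 0 \<longrightarrow> \<delta> \<longlonglongrightarrow> 0 \<longrightarrow>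
      (\<forall>\<^sub>F n in sequentially.
        measure (M n) {\<omega> \<in> space (M n).
          ereal_of_enat (t_mix n (\<lambda>t. G n t \<omega>) (\<epsilon> n)) \<le> ereal (c * real n)} < 1 - \<delta> n))"
proof (intro exI[of _ 1] conjI allI impI)
  fix \<epsilon> \<delta> :: "nat \<Rightarrow> real"
  assume \<epsilon>: "\<epsilon> \<longlonglongrightarrow> 0" and \<delta>: "\<delta> \<longlonglongrightarrow> 0"
  define bound where "bound n = 1 / sqrt (real n) + ln (real n) / (2 * real n)" for n
  have "bound \<longlonglongrightarrow> 0"
    unfolding bound_def by real_asymp
  then have "(\<lambda>n. bound n + \<delta> n) \<longlonglongrightarrow> 0"
    using tendsto_add[OF _ \<delta>] by fastforce
  then have "\<forall>\<^sub>F n in sequentially. bound n + \<delta> n < 1"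
    by (rule order_tendstoD) simp
  moreover have "\<forall>\<^sub>F n in sequentially. \<epsilon> n < 1 / 2"
    using \<epsilon> by (rule order_tendstoD) simp
  moreover have "\<forall>\<^sub>F n in sequentially. p n / (p n + q n) + real n * p n \<le> ln (real n) / (4 * real n)"
    using assms(1-4) by (intro stationary_edge_density_le) auto
  ultimately show "\<forall>\<^sub>F n in sequentially. measure (M n) {\<omega> \<in> space (M n).
      ereal_of_enat (t_mix n (\<lambda>t. G n t \<omega>) (\<epsilon> n)) \<le> ereal (1 * real n)} < 1 - \<delta> n"
    using eventually_ge_at_top[of 2]
  proof eventually_elim
    case (elim n)
    interpret edge_markovian "M n" n "p n" "q n" "erdos_renyi n (p n / (p n + q n))" "G n"
      by (rule assms(5))
    define r where "r = p n / (p n + q n)"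
    define a where "a = (1 - r) * (1 - p n) ^ n"
    have p: "0 \<le> p n" "p n \<le> 1" and r: "0 \<le> r" "r \<le> 1"
      using assms(1,2)[of n] by (auto simp: r_def divide_le_eq_1)
    \<comment> \<open>Bernoulli's inequality turns the product \<open>a\<close> into the union bound.\<close>
    have "1 - r - real n * p n \<le> 1 - r - real n * p n * (1 - r)"
      using p r by (simp add: mult_left_le)
    also have "\<dots> = (1 - r) * (1 + real n * (- p n))"
      by (simp add: algebra_simps)
    also have "\<dots> \<le> (1 - r) * (1 + (- p n)) ^ n"
      using p r by (intro mult_left_mono Bernoulli_inequality) auto
    finally have a_ge: "1 - ln (real n) / (4 * real n) \<le> a"
      using elim(3) by (simp add: a_def r_def)
    have a_le: "a \<le> 1"
      unfolding a_def using p r by (intro mult_le_one power_le_one) auto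
    have "ln (real n) / (4 * real n) < 1"
      using elim(4) ln_bound[of "real n"] by (simp add: divide_simps)
    then have a_pos: "a > 0" using a_ge by simp
    have "{\<omega> \<in> space (M n). ereal_of_enat (t_mix n (\<lambda>t. G n t \<omega>) (\<epsilon> n)) \<le> ereal (1 * real n)} =
        {\<omega> \<in> space (M n). t_mix n (\<lambda>t. G n t \<omega>) (\<epsilon> n) \<le> enat n}"
      by (simp flip: ereal_of_enat_simps(1))
    also have "prob \<dots> \<le> 1 / (real n * a ^ (n - 1)) + (1 / a - 1)"
      using elim p r a_pos by (intro prob_t_mix_le[where r = r]) (auto simp: a_def r_def)
    also have "\<dots> \<le> bound n"
      unfolding bound_def using elim(4) a_ge a_le by (intro second_moment_bound) auto
    also have "\<dots> < 1 - \<delta> n"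
      using elim(1) by simp
    finally show ?case .
  qed
qed simp

end
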